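(* Let $k\geq 1$ be a fixed integer. There exists a probability law $\nu_k$ on $\mathbf{R}^+=[0,+\infty[$ such that $\mathfrak{S}(\mathbf{h})$, for $\mathbf{h}$ with distinct components and $|\mathbf{h}|\leq h$, becomes equidistributed with respect to $\nu_k$ as $h\to+\infty$, i.e. $$\lim_{h\to+\infty}\frac{1}{h^k}\sum_{\substack{|\mathbf{h}|\leq h\\ h_i\text{ distinct}}}f(\mathfrak{S}(\mathbf{h}))=\int_{\mathbf{R}^+}f(t)\,d\nu_k(t)$$ for any bounded continuous function $f$ on $\mathbf{R}$, where the sum is over $k$-tuples $\mathbf{h}=(h_1,\ldots,h_k)$ of pairwise distinct integers with $1\leq h_i\leq h$ for all $i$.
   Context: For a $k$-tuple $\mathbf{h}=(h_1,\ldots,h_k)$ of distinct positive integers, put $|\mathbf{h}|=\max_i h_i$. For a prime $p$, let $\nu_p(\mathbf{h})$ be the cardinality of the set of reductions $\{h_1,\ldots,h_k\}$ modulo $p$. The singular series of $\mathbf{h}$ is the absolutely convergent Euler product over primes $$\mathfrak{S}(\mathbf{h})=\prod_p\Bigl(1-\frac{\nu_p(\mathbf{h})}{p}\Bigr)\Bigl(1-\frac1p\Bigr)^{-k}.$$ *)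

theory Defs
  imports "HOL-Probability.Probability" "HOL-Computational_Algebra.Primes"
begin

text \<open>A \<open>k\<close>-tuple is an extensional function on the index set \<open>{1..k}\<close>.\<close>

definition tuple_max :: "nat \<Rightarrow> (nat \<Rightarrow> nat) \<Rightarrow> nat" where
  "tuple_max k h = Max (h ` {1..k})"

definition distinct_tuples :: "nat \<Rightarrow> real \<Rightarrow> (nat \<Rightarrow> nat) set" where
  "distinct_tuples k H =
     {h \<in> {1..k} \<rightarrow>\<^sub>E {1..}. inj_on h {1..k} \<and> real (tuple_max k h) \<le> H}"

definition num_residues :: "nat \<Rightarrow> (nat \<Rightarrow> nat) \<Rightarrow> nat \<Rightarrow> nat" where
  "num_residues k h p = card ((\<lambda>i. h i mod p) ` {1..k})"

definition euler_factor :: "nat \<Rightarrow> (nat \<Rightarrow> nat) \<Rightarrow> nat \<Rightarrow> real" where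
  "euler_factor k h p = (1 - real (num_residues k h p) / real p) / (1 - 1 / real p) ^ k"

text \<open>The product over primes is taken over all naturals, with factor 1 at the non-primes. It may
  contain zero factors (when all residues mod \<open>p\<close> occur); \<^const>\<open>prodinf\<close> then has value 0. It
  converges absolutely when the components are distinct, see \<open>abs_convergent_singular_series\<close>.\<close>

definition singular_series :: "nat \<Rightarrow> (nat \<Rightarrow> nat) \<Rightarrow> real" where
  "singular_series k h = prodinf (\<lambda>p. if prime p then euler_factor k h p else 1)"

lemma distinct_tuples_eq:
  assumes "k \<ge> 1"
  shows "distinct_tuples k H = {h \<in> {1..k} \<rightarrow>\<^sub>E {1..nat \<lfloor>H\<rfloor>}. inj_on h {1..k}}"
proof -
  have "real (tuple_max k h) \<le> H \<longleftrightarrow> (\<forall>i\<in>{1..k}. h i \<le> nat \<lfloor>H\<rfloor>)"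
    if "h \<in> {1..k} \<rightarrow>\<^sub>E {1..}" for h
  proof -
    have ne: "finite (h ` {1..k})" "h ` {1..k} \<noteq> {}" using assms by auto
    have "h 1 \<ge> 1" using that assms by (auto simp: PiE_iff)
    moreover have "h 1 \<le> tuple_max k h"
      unfolding tuple_max_def using ne assms by (intro Max_ge) auto
    ultimately have "tuple_max k h > 0" by simp
    then have "real (tuple_max k h) \<le> H \<longleftrightarrow> tuple_max k h \<le> nat \<lfloor>H\<rfloor>"
      by linarith
    also have "\<dots> \<longleftrightarrow> (\<forall>i\<in>{1..k}. h i \<le> nat \<lfloor>H\<rfloor>)"
      unfolding tuple_max_def using ne by (subst Max_le_iff) auto
    finally show ?thesis .
  qed
  then show ?thesis
    unfolding distinct_tuples_def by (auto simp: PiE_iff)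
qed

lemma finite_distinct_tuples: "k \<ge> 1 \<Longrightarrow> finite (distinct_tuples k H)"
  by (subst distinct_tuples_eq) (auto intro!: finite_subset[OF _ finite_PiE[of "{1..k}" "\<lambda>_. {1..nat \<lfloor>H\<rfloor>}"]])

lemma one_minus_power_upper:
  fixes x :: real
  assumes "0 \<le> x" "x \<le> 1"
  shows "(1 - x) ^ k \<le> 1 - real k * x + (real k)\<^sup>2 * x\<^sup>2"
proof (induction k)
  case (Suc k)
  have "(1 - x) ^ Suc k \<le> (1 - x) * (1 - real k * x + (real k)\<^sup>2 * x\<^sup>2)"
    using Suc assms by (auto intro!: mult_left_mono)
  also have "\<dots> = 1 - real (Suc k) * x + (real (Suc k))\<^sup>2 * x\<^sup>2
                   - (real k * x\<^sup>2 + x\<^sup>2 + (real k)\<^sup>2 * x\<^sup>2 * x)"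
    by (simp add: algebra_simps power2_eq_square)
  also have "\<dots> \<le> 1 - real (Suc k) * x + (real (Suc k))\<^sup>2 * x\<^sup>2"
  proof -
    have "0 \<le> real k * x\<^sup>2 + x\<^sup>2 + (real k)\<^sup>2 * x\<^sup>2 * x"
      using assms by (intro add_nonneg_nonneg mult_nonneg_nonneg) auto
    then show ?thesis by linarith
  qed
  finally show ?case .
qed simp

lemma abs_convergent_singular_series:
  assumes "inj_on h {1..k}"
  shows "abs_convergent_prod (\<lambda>p. if prime p then euler_factor k h p else 1)"
proof -
  define f where "f = (\<lambda>p. if prime p then euler_factor k h p else 1)"
  have "summable (\<lambda>n. 2 ^ k * (real k)\<^sup>2 * (1 / real n)\<^sup>2)"
    using inverse_power_summable[of 2, where ?'a = real]
    by (intro summable_mult) (simp add: field_simps)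
  moreover have "eventually (\<lambda>n. norm (norm (f n - 1)) \<le> 2 ^ k * (real k)\<^sup>2 * (1 / real n)\<^sup>2) sequentially"
    using eventually_gt_at_top[of "Max (insert 1 (h ` {1..k}))"]
  proof eventually_elim
    case (elim n)
    then have n: "n > 1" "\<And>i. i \<in> {1..k} \<Longrightarrow> h i < n" by auto
    have "(\<lambda>i. h i mod n) ` {1..k} = h ` {1..k}"
      using n by (intro image_cong) auto
    then have nu: "num_residues k h n = k"
      using assms by (simp add: num_residues_def card_image)
    define x where "x = 1 / real n"
    have x: "0 \<le> x" "x \<le> 1 / 2" using n by (auto simp: x_def field_simps)
    have lo: "1 - real k * x \<le> (1 - x) ^ k"
      using Bernoulli_inequality[of "- x" k] x by simp
    have up: "(1 - x) ^ k \<le> 1 - real k * x + (real k)\<^sup>2 * x\<^sup>2"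
      using one_minus_power_upper[of x k] x by simp
    have half: "(1 / 2) ^ k \<le> (1 - x) ^ k" using x by (intro power_mono) auto
    have pos: "(1 - x) ^ k > 0" using x by simp
    have "\<bar>(1 - real k * x) / (1 - x) ^ k - 1\<bar> = ((1 - x) ^ k - (1 - real k * x)) / (1 - x) ^ k"
    proof -
      have "(1 - real k * x) / (1 - x) ^ k - 1 = - (((1 - x) ^ k - (1 - real k * x)) / (1 - x) ^ k)"
        using pos x by (simp add: diff_divide_distrib)
      moreover have "((1 - x) ^ k - (1 - real k * x)) / (1 - x) ^ k \<ge> 0"
        using pos lo by simp
      ultimately show ?thesis by (metis abs_minus_cancel abs_of_nonneg)
    qed
    also have "\<dots> \<le> ((real k)\<^sup>2 * x\<^sup>2) / (1 / 2) ^ k"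
      using lo up half by (intro frac_le) auto
    finally have "\<bar>(1 - real k * x) / (1 - x) ^ k - 1\<bar> \<le> 2 ^ k * (real k)\<^sup>2 * x\<^sup>2"
      by (simp add: power_divide mult_ac)
    moreover have "euler_factor k h n = (1 - real k * x) / (1 - x) ^ k"
      by (simp add: euler_factor_def nu x_def)
    ultimately show ?case
      by (auto simp: f_def x_def)
  qed
  ultimately have "summable (\<lambda>n. norm (f n - 1))"
    by (rule summable_comparison_test_ev[rotated])
  then show ?thesis
    by (simp add: f_def abs_convergent_prod_conv_summable)
qed

lemma singular_series_has_prod:
  assumes "inj_on h {1..k}"
  shows "(\<lambda>p. if prime p then euler_factor k h p else 1) has_prod singular_series k h"
  unfolding singular_series_def
  using abs_convergent_singular_series[OF assms]
  by (intro convergent_prod_has_prod abs_convergent_prod_imp_convergent_prod)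

end

theory Submission
  imports Defs
begin

text \<open>
  Truncate the Euler product at the primes \<open>p \<le> y\<close>. The truncation is periodic in every \<open>h\<^sub>i\<close>, so
  the averages of any function of it converge. A prime \<open>p > y\<close> contributes \<open>1 + O(1/p\<^sup>2)\<close>, or
  \<open>1 + O(1/p)\<close> if \<open>p\<close> divides some \<open>h\<^sub>i - h\<^sub>j\<close>; for \<open>h\<^sub>i \<noteq> h\<^sub>j\<close> the latter has frequency at most
  \<open>2/p\<close> among tuples in \<open>{1..N}\<^sup>k\<close>, without an error term even for \<open>p\<close> large compared to \<open>N\<close>. Hence the mean over the distinct tuples
  of \<open>\<Sum>\<^sub>p\<^sub>>\<^sub>y \<bar>factor - 1\<bar>\<close> tends to 0 as \<open>y \<rightarrow> \<infinity>\<close>, uniformly in \<open>N\<close>. This shows that the truncations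
  approximate the singular series in probability, so that its averages against bounded continuous
  functions converge, and that the empirical laws are tight. Helly's selection theorem then yields the
  limit law.
\<close>

section \<open>Truncated Euler products and their tails\<close>

definition local_factor :: "nat \<Rightarrow> (nat \<Rightarrow> nat) \<Rightarrow> nat \<Rightarrow> real" where
  "local_factor k h n = (if prime n then euler_factor k h n else 1)"

definition truncated_series :: "nat \<Rightarrow> (nat \<Rightarrow> nat) \<Rightarrow> nat \<Rightarrow> real" where
  "truncated_series k h y = (\<Prod>n\<le>y. local_factor k h n)"

text \<open>The shift by \<open>Suc y\<close> starts the sum at \<open>y + 1\<close>, the first
  index that \<open>truncated_series\<close> leaves out; non-prime indices contribute 0.\<close>

definition tail_sum :: "nat \<Rightarrow> (nat \<Rightarrow> nat) \<Rightarrow> nat \<Rightarrow> real" where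
  "tail_sum k h y = (\<Sum>n. \<bar>local_factor k h (n + Suc y) - 1\<bar>)"

abbreviation cube :: "nat \<Rightarrow> nat \<Rightarrow> (nat \<Rightarrow> nat) set" where
  "cube k N \<equiv> {1..k} \<rightarrow>\<^sub>E {1..N}"

lemma finite_cube: "finite (cube k N)"
  by (intro finite_PiE) auto

lemma card_cube: "card (cube k N) = N ^ k"
  by (subst card_PiE) auto

section \<open>Size of a single Euler factor\<close>

lemma num_residues_le: "num_residues k h p \<le> k"
  unfolding num_residues_def using card_image_le[of "{1..k}" "\<lambda>i. h i mod p"] by simp

text \<open>For \<open>n \<ge> 2\<close> the denominator \<open>(1 - 1 / n) ^ k\<close> is at least
  \<open>(1 / 2) ^ k\<close>, so dividing by it costs at most a factor \<open>2 ^ k\<close>.\<close>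

lemma euler_factor_diff:
  assumes "n \<ge> 2"
  shows "\<bar>euler_factor k h n - 1\<bar>
     \<le> 2 ^ k * \<bar>(1 - real (num_residues k h n) / n) - (1 - 1 / n) ^ k\<bar>"
proof -
  define A where "A = 1 - real (num_residues k h n) / n"
  define B where "B = (1 - 1 / real n) ^ k"
  have "(1 / 2) ^ k \<le> B"
    unfolding B_def using assms by (intro power_mono) (auto simp: field_simps)
  moreover have "(0::real) < (1 / 2) ^ k" by simp
  ultimately have B: "B > 0" by linarith
  have "1 / B \<le> 1 / (1 / 2) ^ k"
    using \<open>(1 / 2) ^ k \<le> B\<close> by (intro divide_left_mono) (use B in auto)
  then have B': "1 / B \<le> 2 ^ k" by (simp add: power_divide)
  have "euler_factor k h n - 1 = (1 / B) * (A - B)"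
  proof -
    have "euler_factor k h n = A / B" by (simp add: euler_factor_def A_def B_def)
    then show ?thesis using B by (simp add: diff_divide_distrib)
  qed
  then have "\<bar>euler_factor k h n - 1\<bar> = (1 / B) * \<bar>A - B\<bar>"
    using B by (simp add: abs_mult)
  also have "\<dots> \<le> 2 ^ k * \<bar>A - B\<bar>"
    using B' by (intro mult_right_mono) auto
  finally show ?thesis by (simp add: A_def B_def)
qed

text \<open>The numerator and the denominator of the factor both lie between
  \<open>1 - k / n\<close> and 1, the latter by Bernoulli's inequality. This weak bound serves the
  primes modulo which two components coincide.\<close>

lemma euler_factor_near_1:
  assumes "n \<ge> 2"
  shows "\<bar>euler_factor k h n - 1\<bar> \<le> 2 ^ k * (real k / n)"
proof -
  have "1 + real k * (- (1 / n)) \<le> (1 + (- (1 / n))) ^ k"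
    using assms by (intro Bernoulli_inequality) auto
  then have "1 - real k / n \<le> (1 - 1 / n) ^ k" "(1 - 1 / n) ^ k \<le> 1"
    using assms by (auto intro!: power_le_one)
  moreover have "real (num_residues k h n) / n \<le> real k / n" "real (num_residues k h n) / n \<ge> 0"
    using num_residues_le by (auto intro!: divide_right_mono)
  ultimately have "\<bar>(1 - real (num_residues k h n) / n) - (1 - 1 / n) ^ k\<bar> \<le> real k / n"
    by linarith
  then show ?thesis
    by (intro order_trans[OF euler_factor_diff[OF assms]] mult_left_mono) auto
qed

text \<open>With \<open>k\<close> different residues the numerator is exactly
  \<open>1 - k / n\<close>, which cancels the linear part of \<open>(1 - 1 / n) ^ k\<close>; only a
  quadratic error survives.\<close>

lemma euler_factor_near_1_inj:
  assumes "n \<ge> 2" "inj_on (\<lambda>i. h i mod n) {1..k}"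
  shows "\<bar>euler_factor k h n - 1\<bar> \<le> 2 ^ k * ((real k)\<^sup>2 / (real n)\<^sup>2)"
proof -
  have nu: "num_residues k h n = k"
    using assms(2) by (simp add: num_residues_def card_image)
  have "1 + real k * (- (1 / n)) \<le> (1 + (- (1 / n))) ^ k"
    using assms by (intro Bernoulli_inequality) auto
  moreover have "(1 - 1 / n) ^ k \<le> 1 - real k * (1 / n) + (real k)\<^sup>2 * (1 / n)\<^sup>2"
    using assms by (intro one_minus_power_upper) auto
  ultimately have "\<bar>(1 - real (num_residues k h n) / n) - (1 - 1 / n) ^ k\<bar> \<le> (real k)\<^sup>2 / (real n)\<^sup>2"
    by (simp add: nu power_divide)
  then show ?thesis
    by (intro order_trans[OF euler_factor_diff[OF assms(1)]] mult_left_mono) auto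
qed

section \<open>Counting tuples with equal or congruent components\<close>

text \<open>Such \<open>y\<close> differ from \<open>b\<close> by a nonzero multiple of
  \<open>n\<close> of size at most \<open>N\<close>, which leaves \<open>N div n\<close> distances
  on either side. Excluding \<open>y = b\<close> removes the usual additive error, so the bound
  stays useful for \<open>n > N\<close>, where the count is 0.\<close>

lemma card_congruent_distinct_le:
  assumes "b \<in> {1..N}" "n > 0"
  shows "real (card {y \<in> {1..N}. b \<noteq> y \<and> b mod n = y mod n}) \<le> 2 * real N / n"
proof -
  define M where "M = (\<lambda>t. t * n) ` {1..N div n}"
  \<comment> \<open>The difference \<open>b - m\<close> may truncate to 0 in the naturals; this is
    harmless because only an inclusion is claimed.\<close>
  have "{y \<in> {1..N}. b \<noteq> y \<and> b mod n = y mod n} \<subseteq> (\<lambda>m. b - m) ` M \<union> (\<lambda>m. b + m) ` M"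
  proof safe
    fix y assume y: "y \<in> {1..N}" "b \<noteq> y" "b mod n = y mod n" "y \<notin> (\<lambda>m. b + m) ` M"
    have *: "d \<in> M" if "n dvd d" "0 < d" "d \<le> N" for d
    proof -
      obtain t where t: "d = t * n" using \<open>n dvd d\<close> by (metis dvdE mult.commute)
      have "t \<le> N div n" using that t \<open>n > 0\<close> by (simp add: less_eq_div_iff_mult_less_eq)
      moreover have "t \<ge> 1" using that t by (cases t) auto
      ultimately show ?thesis unfolding M_def t by auto
    qed
    show "y \<in> (\<lambda>m. b - m) ` M"
    proof (cases "y < b")
      case True
      then have "n dvd b - y" using y mod_eq_dvd_iff_nat[of y b n] by simp
      then have "b - y \<in> M" using * True assms by auto
      then show ?thesis using True by (intro image_eqI[of _ _ "b - y"]) auto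
    next
      case False
      then have "n dvd y - b" using y mod_eq_dvd_iff_nat[of b y n] by simp
      then have "y - b \<in> M" using * False y by auto
      then have "y \<in> (\<lambda>m. b + m) ` M" using False by (intro image_eqI[of _ _ "y - b"]) auto
      then show ?thesis using y by auto
    qed
  qed
  then have "card {y \<in> {1..N}. b \<noteq> y \<and> b mod n = y mod n} \<le> card ((\<lambda>m. b - m) ` M \<union> (\<lambda>m. b + m) ` M)"
    by (intro card_mono) (auto simp: M_def)
  also have "\<dots> \<le> card M + card M"
    by (intro order_trans[OF card_Un_le] add_mono card_image_le) (auto simp: M_def)
  also have "card M \<le> N div n"
    unfolding M_def by (intro order_trans[OF card_image_le]) auto
  finally have "card {y \<in> {1..N}. b \<noteq> y \<and> b mod n = y mod n} \<le> 2 * (N div n)" by simp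
  moreover have "real (N div n) \<le> real N / n" by (rule of_nat_div_le_of_nat)
  ultimately show ?thesis by linarith
qed

text \<open>Once all components other than the \<open>j\<close>-th are fixed, which can be done in
  \<open>N ^ (k - 1)\<close> ways, at most \<open>c\<close> values remain for \<open>h j\<close>.
  The relation \<open>P\<close> is kept general to cover both equality and congruence of two
  components.\<close>

lemma card_cube_pair_le:
  fixes c :: real
  assumes "i \<in> {1..k}" "j \<in> {1..k}" "i \<noteq> j"
    and le: "\<And>b. b \<in> {1..N} \<Longrightarrow> real (card {y \<in> {1..N}. P b y}) \<le> c"
  shows "real (card {h \<in> cube k N. P (h i) (h j)}) \<le> c * real N ^ (k - 1)"
proof -
  define G where "G = ({1..k} - {j}) \<rightarrow>\<^sub>E {1..N}"
  have finG: "finite G" unfolding G_def by (intro finite_PiE) auto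
  have cardG: "card G = N ^ (k - 1)" unfolding G_def using assms by (subst card_PiE) auto
  have "{h \<in> cube k N. P (h i) (h j)} \<subseteq> (\<lambda>(g, y). g(j := y)) ` (SIGMA g:G. {y \<in> {1..N}. P (g i) y})"
  proof safe
    fix h assume h: "h \<in> cube k N" "P (h i) (h j)"
    have "h = (h(j := undefined))(j := h j)" by simp
    moreover have "h(j := undefined) \<in> G"
      using h assms by (auto simp: G_def PiE_iff extensional_def)
    ultimately show "h \<in> (\<lambda>(g, y). g(j := y)) ` (SIGMA g:G. {y \<in> {1..N}. P (g i) y})"
      using h assms by (intro image_eqI[of _ _ "(h(j := undefined), h j)"]) auto
  qed
  then have "card {h \<in> cube k N. P (h i) (h j)} \<le> card (SIGMA g:G. {y \<in> {1..N}. P (g i) y})"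
    using finG by (intro surj_card_le) auto
  also have "\<dots> = (\<Sum>g\<in>G. card {y \<in> {1..N}. P (g i) y})"
    using finG by (intro card_SigmaI) auto
  finally have "real (card {h \<in> cube k N. P (h i) (h j)}) \<le> real (\<Sum>g\<in>G. card {y \<in> {1..N}. P (g i) y})"
    by (rule of_nat_mono)
  also have "\<dots> = (\<Sum>g\<in>G. real (card {y \<in> {1..N}. P (g i) y}))"
    by (rule of_nat_sum)
  also have "\<dots> \<le> (\<Sum>g\<in>G. c)"
    using assms by (intro sum_mono le) (auto simp: G_def PiE_iff)
  finally show ?thesis by (simp add: cardG mult.commute)
qed

definition distinct_pairs :: "nat \<Rightarrow> (nat \<times> nat) set" where
  "distinct_pairs k = {(i, j) \<in> {1..k} \<times> {1..k}. i \<noteq> j}"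

lemma finite_distinct_pairs: "finite (distinct_pairs k)"
  unfolding distinct_pairs_def by (rule finite_subset[of _ "{1..k} \<times> {1..k}"]) auto

lemma card_distinct_pairs_le: "card (distinct_pairs k) \<le> k ^ 2"
proof -
  have "card (distinct_pairs k) \<le> card ({1..k} \<times> {1..k})"
    unfolding distinct_pairs_def by (intro card_mono) auto
  then show ?thesis by (simp add: power2_eq_square)
qed

text \<open>A union bound over the pairs of indices: for each pair, \<open>h i\<close> determines
  \<open>h j\<close>. Tuples with a repeated component thus have density of order
  \<open>1 / N\<close> and do not affect limits of averages.\<close>

lemma card_not_inj_le:
  "real (card {h \<in> cube k N. \<not> inj_on h {1..k}}) \<le> real k ^ 2 * real N ^ (k - 1)"
proof -
  define I where "I = distinct_pairs k"
  have finI: "finite I" unfolding I_def by (rule finite_distinct_pairs)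
  have cardI: "card I \<le> k ^ 2" unfolding I_def by (rule card_distinct_pairs_le)
  have "{h \<in> cube k N. \<not> inj_on h {1..k}} \<subseteq> (\<Union>(i, j)\<in>I. {h \<in> cube k N. h i = h j})"
  proof
    fix h assume h: "h \<in> {h \<in> cube k N. \<not> inj_on h {1..k}}"
    then obtain i j where "i \<in> {1..k}" "j \<in> {1..k}" "h i = h j" "i \<noteq> j"
      unfolding inj_on_def by blast
    then have "(i, j) \<in> I" "h \<in> {h \<in> cube k N. h i = h j}"
      using h by (simp_all add: I_def distinct_pairs_def)
    then show "h \<in> (\<Union>(i, j)\<in>I. {h \<in> cube k N. h i = h j})" by blast
  qed
  then have "card {h \<in> cube k N. \<not> inj_on h {1..k}} \<le> card (\<Union>(i, j)\<in>I. {h \<in> cube k N. h i = h j})"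
    using finI finite_cube by (intro card_mono) auto
  also have "\<dots> \<le> (\<Sum>(i, j)\<in>I. card {h \<in> cube k N. h i = h j})"
    using card_UN_le[OF finI, of "\<lambda>(i, j). {h \<in> cube k N. h i = h j}"] by (simp add: case_prod_unfold)
  finally have "real (card {h \<in> cube k N. \<not> inj_on h {1..k}})
      \<le> real (\<Sum>(i, j)\<in>I. card {h \<in> cube k N. h i = h j})"
    by (rule of_nat_mono)
  also have "\<dots> = (\<Sum>(i, j)\<in>I. real (card {h \<in> cube k N. h i = h j}))"
    by (simp add: case_prod_unfold)
  also have "\<dots> \<le> (\<Sum>(i, j)\<in>I. 1 * real N ^ (k - 1))"
  proof (rule sum_mono, clarify)
    fix i j assume "(i, j) \<in> I"
    then show "real (card {h \<in> cube k N. h i = h j}) \<le> 1 * real N ^ (k - 1)"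
    proof (intro card_cube_pair_le)
      fix b assume "b \<in> {1..N}"
      then have "{y \<in> {1..N}. b = y} = {b}" by auto
      then show "real (card {y \<in> {1..N}. b = y}) \<le> 1" by simp
    qed (auto simp: I_def distinct_pairs_def)
  qed
  also have "\<dots> = real (card I) * real N ^ (k - 1)" by simp
  also have "\<dots> \<le> real (k ^ 2) * real N ^ (k - 1)"
    using cardI by (intro mult_right_mono) (auto simp del: of_nat_power)
  finally show ?thesis by simp
qed

section \<open>The mean of the tail over distinct tuples\<close>

text \<open>A collision modulo a prime \<open>n\<close> worsens the deviation from order
  \<open>1 / n\<^sup>2\<close> to \<open>1 / n\<close>, but each pair of indices collides for at
  most \<open>2 * N ^ k / n\<close> tuples, which restores the lost power of \<open>n\<close> on
  average. Injectivity matters: equal components would collide modulo every prime.\<close>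

lemma sum_local_factor_diff_le:
  assumes "k \<ge> 1"
  shows "(\<Sum>h\<in>{h \<in> cube k N. inj_on h {1..k}}. \<bar>local_factor k h n - 1\<bar>)
     \<le> real N ^ k * (2 ^ k * (real k ^ 2 + 2 * real k ^ 3) / (real n)\<^sup>2)"
proof (cases "prime n")
  case True
  then have n: "n \<ge> 2" by (rule prime_ge_2_nat)
  define D where "D = {h \<in> cube k N. inj_on h {1..k}}"
  define I where "I = distinct_pairs k"
  define Q where "Q = (\<lambda>h (i :: nat, j :: nat). h i \<noteq> h j \<and> h i mod n = (h j :: nat) mod n)"
  have finD: "finite D" unfolding D_def using finite_cube by auto
  have "card D \<le> card (cube k N)"
    unfolding D_def using finite_cube by (intro card_mono) auto
  then have cardD: "card D \<le> N ^ k" by (simp only: card_cube)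
  have finI: "finite I" unfolding I_def by (rule finite_distinct_pairs)
  have cardI: "card I \<le> k ^ 2" unfolding I_def by (rule card_distinct_pairs_le)
  \<comment> \<open>The last sum counts the colliding pairs: it is nonnegative, and at least 1 as
    soon as a collision occurs, so one inequality covers both cases.\<close>
  have pw: "\<bar>local_factor k h n - 1\<bar> \<le> 2 ^ k * ((real k)\<^sup>2 / (real n)\<^sup>2)
              + 2 ^ k * (real k / n) * (\<Sum>ij\<in>I. of_bool (Q h ij))" if "h \<in> D" for h
  proof (cases "inj_on (\<lambda>i. h i mod n) {1..k}")
    case True
    have "0 \<le> 2 ^ k * (real k / n) * (\<Sum>ij\<in>I. of_bool (Q h ij))"
      by (intro mult_nonneg_nonneg sum_nonneg) auto
    then show ?thesis
      using euler_factor_near_1_inj[OF n True] \<open>prime n\<close> unfolding local_factor_def by auto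
  next
    case False
    then obtain i j where ij: "i \<in> {1..k}" "j \<in> {1..k}" "h i mod n = h j mod n" "i \<noteq> j"
      unfolding inj_on_def by blast
    then have "h i \<noteq> h j" using that inj_onD[of h "{1..k}" i j] by (auto simp: D_def)
    then have "(1::real) = of_bool (Q h (i, j))" using ij by (simp add: Q_def)
    also have "\<dots> \<le> (\<Sum>ij\<in>I. of_bool (Q h ij))"
      using ij finI by (intro member_le_sum) (auto simp: I_def distinct_pairs_def)
    finally have "2 ^ k * (real k / n) * 1 \<le> 2 ^ k * (real k / n) * (\<Sum>ij\<in>I. of_bool (Q h ij))"
      by (intro mult_left_mono) auto
    moreover have "0 \<le> 2 ^ k * ((real k)\<^sup>2 / (real n)\<^sup>2)" by simp
    moreover have "\<bar>local_factor k h n - 1\<bar> \<le> 2 ^ k * (real k / n)"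
      using euler_factor_near_1[OF n] \<open>prime n\<close> by (simp add: local_factor_def)
    ultimately show ?thesis by linarith
  qed
  have pair: "(\<Sum>h\<in>D. of_bool (Q h ij)) \<le> 2 * real N ^ k / n" if "ij \<in> I" for ij
  proof -
    obtain i j where ij: "ij = (i, j)" "i \<in> {1..k}" "j \<in> {1..k}" "i \<noteq> j"
      using \<open>ij \<in> I\<close> by (auto simp: I_def distinct_pairs_def)
    have "(\<Sum>h\<in>D. of_bool (Q h ij)) = real (card {h \<in> D. Q h ij})"
      using finD by (simp add: Int_def)
    also have "card {h \<in> D. Q h ij} \<le> card {h \<in> cube k N. h i \<noteq> h j \<and> h i mod n = h j mod n}"
      using finite_cube by (intro card_mono) (auto simp: D_def Q_def ij)
    also have "real (card {h \<in> cube k N. h i \<noteq> h j \<and> h i mod n = h j mod n})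
        \<le> (2 * real N / n) * real N ^ (k - 1)"
      using ij n by (intro card_cube_pair_le card_congruent_distinct_le) auto
    also have "\<dots> = 2 * real N ^ k / n"
      using assms by (cases k) auto
    finally show ?thesis by simp
  qed
  have "(\<Sum>h\<in>D. \<bar>local_factor k h n - 1\<bar>) \<le> (\<Sum>h\<in>D. 2 ^ k * ((real k)\<^sup>2 / (real n)\<^sup>2)
              + 2 ^ k * (real k / n) * (\<Sum>ij\<in>I. of_bool (Q h ij)))"
    by (intro sum_mono pw)
  also have "\<dots> = real (card D) * (2 ^ k * ((real k)\<^sup>2 / (real n)\<^sup>2))
              + 2 ^ k * (real k / n) * (\<Sum>ij\<in>I. \<Sum>h\<in>D. of_bool (Q h ij))"
    by (subst sum.swap) (simp add: sum.distrib sum_distrib_left)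
  also have "\<dots> \<le> real (N ^ k) * (2 ^ k * ((real k)\<^sup>2 / (real n)\<^sup>2))
              + 2 ^ k * (real k / n) * (real (k ^ 2) * (2 * real N ^ k / n))"
  proof (intro add_mono mult_right_mono mult_left_mono)
    show "real (card D) \<le> real (N ^ k)"
      using cardD by (simp del: of_nat_power)
    have "(\<Sum>ij\<in>I. \<Sum>h\<in>D. of_bool (Q h ij)) \<le> (\<Sum>ij\<in>I. 2 * real N ^ k / n)"
      by (intro sum_mono pair)
    also have "\<dots> = real (card I) * (2 * real N ^ k / n)" by simp
    also have "\<dots> \<le> real (k ^ 2) * (2 * real N ^ k / n)"
      using cardI by (intro mult_right_mono) (auto simp del: of_nat_power)
    finally show "(\<Sum>ij\<in>I. \<Sum>h\<in>D. of_bool (Q h ij)) \<le> real (k ^ 2) * (2 * real N ^ k / n)" .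
  qed auto
  also have "\<dots> = real N ^ k * (2 ^ k * (real k ^ 2 + 2 * real k ^ 3) / (real n)\<^sup>2)"
    using n by (simp add: field_simps power2_eq_square power3_eq_cube)
  finally show ?thesis by (simp add: D_def)
qed (simp add: local_factor_def)

text \<open>A tail of a convergent series of order \<open>1 / n\<^sup>2\<close>, summed from
  \<open>y + 1\<close> on. It bounds the mean of \<open>tail_sum\<close> and is free of
  \<open>N\<close>, which makes all later estimates uniform in the side of the cube.\<close>

definition tail_bound :: "nat \<Rightarrow> nat \<Rightarrow> real" where
  "tail_bound k y = (\<Sum>n. 2 ^ k * (real k ^ 2 + 2 * real k ^ 3) / (real (n + Suc y))\<^sup>2)"

lemma summable_tail_bound: "summable (\<lambda>n. 2 ^ k * (real k ^ 2 + 2 * real k ^ 3) / (real n)\<^sup>2)"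
proof -
  have "summable (\<lambda>n. 2 ^ k * (real k ^ 2 + 2 * real k ^ 3) * inverse (real n ^ 2))"
    using inverse_power_summable[of 2, where ?'a = real] by (intro summable_mult) auto
  then show ?thesis by (simp add: divide_inverse)
qed

lemma tail_bound_small:
  assumes "e > 0"
  shows "\<exists>y0. \<forall>y\<ge>y0. tail_bound k y < e"
proof -
  obtain m where m: "\<And>n. n \<ge> m \<Longrightarrow>
      norm (\<Sum>i. 2 ^ k * (real k ^ 2 + 2 * real k ^ 3) / (real (i + n))\<^sup>2) < e"
    using suminf_exist_split[OF assms summable_tail_bound[of k]] by auto
  have "tail_bound k y < e" if "y \<ge> m" for y
    using m[of "Suc y"] that unfolding tail_bound_def by simp
  then show ?thesis by blast
qed

lemma summable_tail:
  assumes "inj_on h {1..k}"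
  shows "summable (\<lambda>n. \<bar>local_factor k h (n + m) - 1\<bar>)"
  using abs_convergent_singular_series[OF assms]
  by (subst summable_iff_shift) (simp add: abs_convergent_prod_conv_summable local_factor_def)

lemma tail_sum_nonneg: "inj_on h {1..k} \<Longrightarrow> tail_sum k h y \<ge> 0"
  unfolding tail_sum_def by (intro suminf_nonneg summable_tail) auto

lemma sum_tail_le:
  assumes "k \<ge> 1"
  shows "(\<Sum>h\<in>{h \<in> cube k N. inj_on h {1..k}}. tail_sum k h y) \<le> real N ^ k * tail_bound k y"
proof -
  define D where "D = {h \<in> cube k N. inj_on h {1..k}}"
  have "(\<Sum>h\<in>D. tail_sum k h y) = (\<Sum>n. \<Sum>h\<in>D. \<bar>local_factor k h (n + Suc y) - 1\<bar>)"
    unfolding tail_sum_def by (rule suminf_sum[symmetric], rule summable_tail) (simp add: D_def)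
  also have "\<dots> \<le> (\<Sum>n. real N ^ k * (2 ^ k * (real k ^ 2 + 2 * real k ^ 3) / (real (n + Suc y))\<^sup>2))"
  proof (rule suminf_le)
    show "(\<Sum>h\<in>D. \<bar>local_factor k h (n + Suc y) - 1\<bar>)
       \<le> real N ^ k * (2 ^ k * (real k ^ 2 + 2 * real k ^ 3) / (real (n + Suc y))\<^sup>2)" for n
      unfolding D_def by (rule sum_local_factor_diff_le[OF assms])
    show "summable (\<lambda>n. \<Sum>h\<in>D. \<bar>local_factor k h (n + Suc y) - 1\<bar>)"
      by (rule summable_sum, rule summable_tail) (simp add: D_def)
    show "summable (\<lambda>n. real N ^ k * (2 ^ k * (real k ^ 2 + 2 * real k ^ 3) / (real (n + Suc y))\<^sup>2))"
      by (rule summable_mult, subst summable_iff_shift[of "\<lambda>n. 2 ^ k * (real k ^ 2 + 2 * real k ^ 3) / (real n)\<^sup>2"],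
          rule summable_tail_bound)
  qed
  also have "\<dots> = real N ^ k * tail_bound k y"
    unfolding tail_bound_def
    by (rule suminf_mult, subst summable_iff_shift[of "\<lambda>n. 2 ^ k * (real k ^ 2 + 2 * real k ^ 3) / (real n)\<^sup>2"],
          rule summable_tail_bound)
  finally show ?thesis by (simp add: D_def)
qed

text \<open>Markov's inequality for \<open>tail_sum\<close> on the distinct tuples.\<close>

lemma card_large_tail_le:
  assumes "k \<ge> 1" "d > 0"
  shows "real (card {h \<in> cube k N. inj_on h {1..k} \<and> tail_sum k h y > d})
     \<le> real N ^ k * tail_bound k y / d"
proof -
  define B where "B = {h \<in> cube k N. inj_on h {1..k} \<and> tail_sum k h y > d}"
  have "d * real (card B) = (\<Sum>h\<in>B. d)" by simp
  also have "\<dots> \<le> (\<Sum>h\<in>B. tail_sum k h y)"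
    by (intro sum_mono) (auto simp: B_def)
  also have "\<dots> \<le> (\<Sum>h\<in>{h \<in> cube k N. inj_on h {1..k}}. tail_sum k h y)"
    using finite_cube by (intro sum_mono2) (auto simp: B_def tail_sum_nonneg)
  also have "\<dots> \<le> real N ^ k * tail_bound k y" by (rule sum_tail_le[OF assms(1)])
  finally show ?thesis using assms by (simp add: B_def field_simps)
qed

section \<open>Comparing truncations with the full product\<close>

text \<open>The extra factors \<open>1 + a n\<close> satisfy \<open>\<bar>\<Prod>(1 + a n) - 1\<bar>
  \<le> \<Prod>(1 + \<bar>a n\<bar>) - 1\<close>, and the last product is at most the exponential of
  the tail. Since neither logarithms of the factors nor divisions by them occur, vanishing factors
  are allowed.\<close>

lemma truncated_series_diff_le:
  assumes "inj_on h {1..k}" "y \<le> m"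
  shows "\<bar>truncated_series k h m - truncated_series k h y\<bar>
     \<le> \<bar>truncated_series k h y\<bar> * (exp (tail_sum k h y) - 1)"
proof -
  define a where "a = (\<lambda>n. local_factor k h n - 1)"
  have "{..m} = {..y} \<union> {y<..m}" using assms by auto
  then have "truncated_series k h m = truncated_series k h y * (\<Prod>n\<in>{y<..m}. 1 + a n)"
    unfolding truncated_series_def by (simp add: a_def) (subst prod.union_disjoint, auto)
  then have "truncated_series k h m - truncated_series k h y
      = truncated_series k h y * ((\<Prod>n\<in>{y<..m}. 1 + a n) - 1)"
    by (simp add: algebra_simps)
  then have "\<bar>truncated_series k h m - truncated_series k h y\<bar>
      = \<bar>truncated_series k h y\<bar> * \<bar>(\<Prod>n\<in>{y<..m}. 1 + a n) - 1\<bar>"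
    by (simp add: abs_mult)
  also have "\<dots> \<le> \<bar>truncated_series k h y\<bar> * (exp (tail_sum k h y) - 1)"
  proof (rule mult_left_mono)
    have "\<bar>(\<Prod>n\<in>{y<..m}. 1 + a n) - 1\<bar> \<le> (\<Prod>n\<in>{y<..m}. 1 + \<bar>a n\<bar>) - 1"
      using norm_prod_minus1_le_prod_minus1[of a "{y<..m}"] by simp
    also have "(\<Prod>n\<in>{y<..m}. 1 + \<bar>a n\<bar>) \<le> exp (\<Sum>n\<in>{y<..m}. \<bar>a n\<bar>)"
      by (rule prod_le_exp_sum) auto
    also have "(\<Sum>n\<in>{y<..m}. \<bar>a n\<bar>) = (\<Sum>n<m - y. \<bar>a (n + Suc y)\<bar>)"
      using assms by (intro sum.reindex_bij_witness[of _ "\<lambda>n. n + Suc y" "\<lambda>n. n - Suc y"]) auto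
    also have "\<dots> \<le> tail_sum k h y"
      unfolding tail_sum_def a_def using assms by (intro sum_le_suminf summable_tail) auto
    finally show "\<bar>(\<Prod>n\<in>{y<..m}. 1 + a n) - 1\<bar> \<le> exp (tail_sum k h y) - 1" by simp
  qed auto
  finally show ?thesis .
qed

lemma truncated_series_LIMSEQ:
  assumes "inj_on h {1..k}"
  shows "truncated_series k h \<longlonglongrightarrow> singular_series k h"
  unfolding truncated_series_def singular_series_def local_factor_def
  using abs_convergent_singular_series[OF assms]
  by (intro convergent_prod_LIMSEQ abs_convergent_prod_imp_convergent_prod)

lemma singular_series_diff_le:
  assumes "inj_on h {1..k}"
  shows "\<bar>singular_series k h - truncated_series k h y\<bar>
     \<le> \<bar>truncated_series k h y\<bar> * (exp (tail_sum k h y) - 1)"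
proof (rule LIMSEQ_le_const2)
  show "(\<lambda>m. \<bar>truncated_series k h m - truncated_series k h y\<bar>)
      \<longlonglongrightarrow> \<bar>singular_series k h - truncated_series k h y\<bar>"
    by (intro tendsto_intros truncated_series_LIMSEQ[OF assms])
qed (use truncated_series_diff_le[OF assms] in blast)

lemma truncated_series_nonneg: "truncated_series k h y \<ge> 0"
proof -
  have "local_factor k h n \<ge> 0" for n
  proof (cases "prime n")
    case True
    then have n: "n \<ge> 2" by (rule prime_ge_2_nat)
    have "num_residues k h n \<le> card {..<n}"
      unfolding num_residues_def using n by (intro card_mono) auto
    then show ?thesis using True n
      by (auto simp: local_factor_def euler_factor_def intro!: divide_nonneg_nonneg)
  qed (simp add: local_factor_def)
  then show ?thesis unfolding truncated_series_def by (intro prod_nonneg) auto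
qed

lemma singular_series_nonneg: "inj_on h {1..k} \<Longrightarrow> singular_series k h \<ge> 0"
  by (rule LIMSEQ_le_const[OF truncated_series_LIMSEQ]) (auto simp: truncated_series_nonneg)

text \<open>A crude bound, factor by factor; what counts is that it depends on \<open>k\<close> and
  \<open>y\<close> but not on \<open>h\<close>.\<close>

lemma truncated_series_le: "truncated_series k h y \<le> (1 + 2 ^ k * real k) ^ Suc y"
proof -
  have "\<bar>local_factor k h n\<bar> \<le> 1 + 2 ^ k * real k" for n
  proof (cases "prime n")
    case True
    then have n: "n \<ge> 2" by (rule prime_ge_2_nat)
    have "2 ^ k * (real k / n) \<le> 2 ^ k * (real k / 1)"
      using n by (intro mult_left_mono divide_left_mono) auto
    then show ?thesis using euler_factor_near_1[OF n, of k h] True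
      by (auto simp: local_factor_def)
  qed (simp add: local_factor_def)
  then have "(\<Prod>n\<le>y. \<bar>local_factor k h n\<bar>) \<le> (\<Prod>n\<le>y. 1 + 2 ^ k * real k)"
    by (intro prod_mono) auto
  then show ?thesis
    unfolding truncated_series_def by (simp add: abs_prod[symmetric])
qed

section \<open>Averages of periodic functions\<close>

text \<open>The right side counts the members of the class in \<open>{0..N}\<close>. The term
  \<open>(q - r) div q\<close> is 1 for \<open>r = 0\<close> and 0 otherwise: it accounts for the
  integer 0, which is missing from \<open>{1..N}\<close>. Adding \<open>q\<close> before subtracting
  \<open>r\<close> avoids truncated subtraction.\<close>

lemma num_residue_class:
  assumes "r < q"
  shows "card {n \<in> {1..N}. n mod q = r} + (q - r) div q = (N + q - r) div q"
proof (induction N)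
  case (Suc N)
  have "(Suc N + q - r) mod q = 0 \<longleftrightarrow> Suc N mod q = r"
  proof -
    have "(Suc N + q - r) mod q = 0 \<longleftrightarrow> q dvd (Suc N + q) - r" by auto
    also have "\<dots> \<longleftrightarrow> (Suc N + q) mod q = r mod q"
      using assms by (intro mod_eq_dvd_iff_nat[symmetric]) auto
    finally show ?thesis using assms by (simp only: mod_add_self2 mod_less)
  qed
  moreover have "(Suc N + q - r) div q = (if (Suc N + q - r) mod q = 0 then Suc ((N + q - r) div q) else (N + q - r) div q)"
    using assms div_Suc[of "N + q - r" q] by (simp add: Suc_diff_le)
  moreover have "{n \<in> {1..Suc N}. n mod q = r} =
      (if Suc N mod q = r then insert (Suc N) {n \<in> {1..N}. n mod q = r} else {n \<in> {1..N}. n mod q = r})"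
    by (auto simp: le_Suc_eq)
  ultimately show ?case using Suc by simp
qed (use assms in simp)

lemma residue_class_density:
  assumes "r < q"
  shows "(\<lambda>N. real (card {n \<in> {1..N}. n mod q = r}) / real N) \<longlonglongrightarrow> 1 / real q"
proof -
  define c where "c = (\<lambda>N. real (card {n \<in> {1..N}. n mod q = r}))"
  have bd: "\<bar>c N - real N / q\<bar> \<le> 2" for N
  proof -
    have q: "real q > 0" using assms by simp
    have "c N + real ((q - r) div q) = real ((N + q - r) div q)"
      unfolding c_def num_residue_class[OF assms, of N, symmetric] by simp
    moreover have "(q - r) div q \<le> q div q" by (intro div_le_mono) auto
    then have "(q - r) div q \<le> 1" using assms by simp
    moreover have "real ((N + q - r) div q) \<le> real (N + q - r) / q"
      by (rule of_nat_div_le_of_nat)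
    moreover have "real (N + q - r) / q < real ((N + q - r) div q) + 1"
    proof -
      have "N + q - r < q + (N + q - r) div q * q"
        using assms by (intro dividend_less_div_times) auto
      then have "real (N + q - r) < real (q + (N + q - r) div q * q)"
        by (simp only: of_nat_less_iff)
      then show ?thesis
        using q unfolding of_nat_add of_nat_mult by (simp add: pos_divide_less_eq algebra_simps)
    qed
    moreover have "real (N + q - r) / q \<le> real N / q + 1" "real N / q \<le> real (N + q - r) / q"
      using assms q by (auto simp: field_simps)
    ultimately show ?thesis by linarith
  qed
  have "(\<lambda>N. c N / real N - 1 / q) \<longlonglongrightarrow> 0"
  proof (rule Lim_null_comparison)
    show "\<forall>\<^sub>F N in sequentially. norm (c N / real N - 1 / q) \<le> 2 / real N"
      using eventually_gt_at_top[of 0]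
    proof eventually_elim
      case (elim N)
      have "c N / real N - 1 / q = (c N - real N / q) / real N"
        using elim by (simp add: diff_divide_distrib)
      then show ?case using bd[of N] elim by (simp add: abs_divide divide_right_mono)
    qed
    show "(\<lambda>N. 2 / real N) \<longlonglongrightarrow> 0" by (rule lim_const_over_n)
  qed
  then show ?thesis unfolding c_def by (simp add: LIM_zero_iff)
qed

text \<open>A periodic function is a finite combination of indicators of residue vectors. The
  average of each indicator over the cube splits into one-dimensional densities, each tending to
  \<open>1 / q\<close>.\<close>

lemma periodic_average:
  fixes g :: "(nat \<Rightarrow> nat) \<Rightarrow> real"
  assumes "q > 0" and periodic: "\<And>h. g (\<lambda>i\<in>{1..k}. h i mod q) = g h"
  shows "(\<lambda>N. (\<Sum>h\<in>cube k N. g h) / real N ^ k) \<longlonglongrightarrow> (\<Sum>r\<in>{1..k} \<rightarrow>\<^sub>E {..<q}. g r) / real q ^ k"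
proof -
  define R where "R = {1..k} \<rightarrow>\<^sub>E {..<q}"
  define c where "c = (\<lambda>N r. real (card {n \<in> {1..N}. n mod q = r}))"
  have finR: "finite R" unfolding R_def by (intro finite_PiE) auto
  have expand: "g h = (\<Sum>r\<in>R. g r * (\<Prod>i\<in>{1..k}. of_bool (h i mod q = r i)))" for h
  proof -
    define s where "s = (\<lambda>i\<in>{1..k}. h i mod q)"
    have "s \<in> R" using \<open>q > 0\<close> by (auto simp: s_def R_def)
    have "(\<Prod>i\<in>{1..k}. of_bool (h i mod q = r i)) = (if s = r then 1 else 0 :: real)" if "r \<in> R" for r
    proof (cases "s = r")
      case False
      then obtain i where "i \<in> {1..k}" "h i mod q \<noteq> r i"
        using \<open>s \<in> R\<close> \<open>r \<in> R\<close> PiE_ext[of s "{1..k}" "\<lambda>_. {..<q}" r] unfolding R_def s_def by force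
      then have "\<exists>i\<in>{1..k}. of_bool (h i mod q = r i) = (0::real)" by auto
      then show ?thesis using False by (simp add: prod_zero)
    qed (auto simp: s_def intro!: prod.neutral)
    then have "(\<Sum>r\<in>R. g r * (\<Prod>i\<in>{1..k}. of_bool (h i mod q = r i))) = (\<Sum>r\<in>R. g r * (if s = r then 1 else 0))"
      by (intro sum.cong) auto
    also have "\<dots> = g s"
      using finR \<open>s \<in> R\<close> by (simp add: if_distrib cong: if_cong)
    finally show ?thesis using periodic[of h] by (simp add: s_def)
  qed
  have "(\<Sum>h\<in>cube k N. g h) / real N ^ k = (\<Sum>r\<in>R. g r * (\<Prod>i\<in>{1..k}. c N (r i) / real N))" for N
  proof -
    have "(\<Sum>h\<in>cube k N. g h) = (\<Sum>h\<in>cube k N. \<Sum>r\<in>R. g r * (\<Prod>i\<in>{1..k}. of_bool (h i mod q = r i)))"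
      by (intro sum.cong refl expand)
    also have "\<dots> = (\<Sum>r\<in>R. g r * (\<Sum>h\<in>cube k N. \<Prod>i\<in>{1..k}. of_bool (h i mod q = r i)))"
      by (subst sum.swap) (simp only: sum_distrib_left)
    \<comment> \<open>Distributivity: summing over the cube a product of functions of single
      coordinates gives the product of the one-dimensional sums.\<close>
    also have "\<dots> = (\<Sum>r\<in>R. g r * (\<Prod>i\<in>{1..k}. \<Sum>n\<in>{1..N}. of_bool (n mod q = r i)))"
      by (subst prod_sum_PiE) auto
    also have "\<dots> = (\<Sum>r\<in>R. g r * (\<Prod>i\<in>{1..k}. c N (r i)))"
      by (simp add: c_def Int_def)
    finally show ?thesis by (simp add: sum_divide_distrib prod_dividef)
  qed
  moreover have "(\<lambda>N. \<Sum>r\<in>R. g r * (\<Prod>i\<in>{1..k}. c N (r i) / real N)) \<longlonglongrightarrow> (\<Sum>r\<in>R. g r * (\<Prod>i\<in>{1..k}. 1 / real q))"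
    unfolding c_def
    by (intro tendsto_sum tendsto_mult tendsto_const tendsto_prod residue_class_density) (auto simp: R_def PiE_iff)
  ultimately show ?thesis
    by (simp add: R_def sum_divide_distrib power_divide)
qed

text \<open>Every prime \<open>n \<le> y\<close> divides \<open>fact y\<close>, so reduction modulo
  \<open>fact y\<close> preserves all residues that enter the truncation.\<close>

lemma truncated_series_periodic:
  "truncated_series k (\<lambda>i\<in>{1..k}. h i mod fact y) y = truncated_series k h y"
  unfolding truncated_series_def
proof (rule prod.cong[OF refl])
  fix n assume "n \<in> {..y}"
  show "local_factor k (\<lambda>i\<in>{1..k}. h i mod fact y) n = local_factor k h n"
  proof (cases "prime n")
    case True
    then have "n dvd fact y"
      using \<open>n \<in> {..y}\<close> prime_gt_0_nat[of n] by (intro dvd_fact) auto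
    then have "num_residues k (\<lambda>i\<in>{1..k}. h i mod fact y) n = num_residues k h n"
      unfolding num_residues_def by (intro arg_cong[of _ _ card] image_cong) (auto simp: mod_mod_cancel)
    then show ?thesis by (simp add: local_factor_def euler_factor_def)
  qed (simp add: local_factor_def)
qed

section \<open>Replacing the singular series by a truncation in averages\<close>

text \<open>The factor \<open>exp 1\<close> absorbs the primes beyond \<open>y\<close> when \<open>tail_sum k h y \<le> 1\<close>.\<close>

definition size_bound :: "nat \<Rightarrow> nat \<Rightarrow> real" where
  "size_bound k y = (1 + 2 ^ k * real k) ^ Suc y * exp 1"

lemma size_bound_pos: "size_bound k y > 0"
  unfolding size_bound_def by (intro mult_pos_pos zero_less_power add_pos_nonneg) auto

text \<open>The bound depends on the level \<open>y\<close> where the tail is controlled and not on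
  \<open>m\<close>, so a later truncation can be refined without enlarging the range of
  values.\<close>

lemma truncated_series_le_size_bound:
  assumes "inj_on h {1..k}" "tail_sum k h y \<le> 1" "y \<le> m"
  shows "truncated_series k h m \<le> size_bound k y"
proof -
  have "truncated_series k h m - truncated_series k h y \<le> truncated_series k h y * (exp (tail_sum k h y) - 1)"
    using truncated_series_diff_le[OF assms(1,3)] truncated_series_nonneg[of k h y] by simp
  then have "truncated_series k h m \<le> truncated_series k h y * exp (tail_sum k h y)"
    by (simp add: algebra_simps)
  also have "\<dots> \<le> (1 + 2 ^ k * real k) ^ Suc y * exp 1"
    using assms truncated_series_le[of k h y] by (intro mult_mono) auto
  finally show ?thesis by (simp add: size_bound_def)
qed

lemma singular_series_le_size_bound:
  assumes "inj_on h {1..k}" "tail_sum k h y \<le> 1"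
  shows "singular_series k h \<le> size_bound k y"
  by (rule LIMSEQ_le_const2[OF truncated_series_LIMSEQ[OF assms(1)]])
     (use truncated_series_le_size_bound[OF assms] in blast)

text \<open>On tuples with repeated components the product need not converge and \<^const>\<open>singular_series\<close> is
  a junk value; setting it to 0 there allows averaging over the whole cube.\<close>

definition series_or_0 :: "nat \<Rightarrow> (nat \<Rightarrow> nat) \<Rightarrow> real" where
  "series_or_0 k h = (if inj_on h {1..k} then singular_series k h else 0)"

lemma series_or_0_nonneg: "series_or_0 k h \<ge> 0"
  by (simp add: series_or_0_def singular_series_nonneg)

text \<open>Two cutoffs are chosen in turn. The first, \<open>y0\<close>, confines most values to a
  compact interval on which \<open>f\<close> is uniformly continuous; the second, \<open>y\<close>,
  then makes the truncation error small relative to that interval. A single cutoff would be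
  circular, since \<open>size_bound\<close> grows with it.\<close>

lemma average_truncation:
  fixes f :: "real \<Rightarrow> real"
  assumes k: "k \<ge> 1" and f: "continuous_on UNIV f" "\<And>x. \<bar>f x\<bar> \<le> B" and "e > 0"
  shows "\<exists>y. \<forall>\<^sub>F N in sequentially.
     \<bar>(\<Sum>h\<in>cube k N. f (series_or_0 k h)) / real N ^ k
       - (\<Sum>h\<in>cube k N. f (truncated_series k h y)) / real N ^ k\<bar> \<le> e"
proof -
  have "B \<ge> 0" using f(2)[of 0] by linarith
  \<comment> \<open>Three exceptional sets of density at most \<open>\<eta>\<close>, each costing at
    most \<open>2 * B\<close> per tuple, add up to \<open>6 * B * \<eta> \<le> e / 2\<close>. The
    summand 1 guards against \<open>B = 0\<close>.\<close>
  define \<eta> where "\<eta> = e / (12 * (B + 1))"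
  have "\<eta> > 0" using \<open>e > 0\<close> \<open>B \<ge> 0\<close> by (simp add: \<eta>_def)
  obtain y0 where y0: "tail_bound k y0 < \<eta>" using tail_bound_small[OF \<open>\<eta> > 0\<close>] by blast
  define K where "K = size_bound k y0"
  have "K > 0" unfolding K_def by (rule size_bound_pos)
  have "uniformly_continuous_on {0..K} f"
    using f(1) by (intro compact_uniformly_continuous) (auto intro: continuous_on_subset)
  then obtain \<delta> where "\<delta> > 0"
    and \<delta>: "\<And>s t. s \<in> {0..K} \<Longrightarrow> t \<in> {0..K} \<Longrightarrow> dist t s < \<delta> \<Longrightarrow> dist (f t) (f s) < e / 2"
    using \<open>e > 0\<close> unfolding uniformly_continuous_on_def by (metis half_gt_zero)
  \<comment> \<open>This \<open>d\<close> solves \<open>K * (exp d - 1) = \<delta> / 2\<close>, so a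
    tail of at most \<open>d\<close> moves a value in \<open>{0..K}\<close> by less than
    \<open>\<delta>\<close>.\<close>
  define d where "d = ln (1 + \<delta> / (2 * K))"
  have "1 + \<delta> / (2 * K) > 1" using \<open>\<delta> > 0\<close> \<open>K > 0\<close> by simp
  then have "d > 0" and expd: "exp d - 1 = \<delta> / (2 * K)" by (auto simp: d_def)
  obtain y1 where y1: "\<And>y. y \<ge> y1 \<Longrightarrow> tail_bound k y < \<eta> * d"
    using tail_bound_small[of "\<eta> * d" k] \<open>\<eta> > 0\<close> \<open>d > 0\<close> by auto
  define y where "y = max y0 y1"
  have "\<forall>\<^sub>F N in sequentially. real k ^ 2 / real N < \<eta>"
    using order_tendstoD(2)[OF lim_const_over_n \<open>\<eta> > 0\<close>] .
  then have "\<forall>\<^sub>F N in sequentially.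
     \<bar>(\<Sum>h\<in>cube k N. f (series_or_0 k h)) / real N ^ k
       - (\<Sum>h\<in>cube k N. f (truncated_series k h y)) / real N ^ k\<bar> \<le> e"
    using eventually_gt_at_top[of 0]
  proof eventually_elim
    case (elim N)
    \<comment> \<open>The exceptional tuples: \<open>T1\<close> has repeated components,
      \<open>T2\<close> may give values above \<open>K\<close>, and \<open>T3\<close> may give a
      truncation error that is too large.\<close>
    define T1 where "T1 = {h \<in> cube k N. \<not> inj_on h {1..k}}"
    define T2 where "T2 = {h \<in> cube k N. inj_on h {1..k} \<and> tail_sum k h y0 > 1}"
    define T3 where "T3 = {h \<in> cube k N. inj_on h {1..k} \<and> tail_sum k h y > d}"
    have Npos: "real N ^ k > 0" using elim by simp
    have "real (card T1) \<le> real k ^ 2 / real N * real N ^ k"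
      using card_not_inj_le[of k N] k elim unfolding T1_def by (cases k) auto
    also have "\<dots> \<le> \<eta> * real N ^ k" using elim by (intro mult_right_mono) auto
    finally have T1: "real (card T1) \<le> \<eta> * real N ^ k" .
    have "real (card T2) \<le> tail_bound k y0 * real N ^ k"
      using card_large_tail_le[OF k, of 1 N y0] by (simp add: T2_def mult.commute)
    also have "\<dots> \<le> \<eta> * real N ^ k" using y0 by (intro mult_right_mono) auto
    finally have T2: "real (card T2) \<le> \<eta> * real N ^ k" .
    have "real (card T3) \<le> (tail_bound k y / d) * real N ^ k"
      using card_large_tail_le[OF k \<open>d > 0\<close>, of N y] by (simp add: T3_def mult.commute)
    also have "\<dots> \<le> \<eta> * real N ^ k"
      using y1[of y] \<open>d > 0\<close> by (intro mult_right_mono) (auto simp: y_def field_simps)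
    finally have T3: "real (card T3) \<le> \<eta> * real N ^ k" .
    have pw: "\<bar>f (series_or_0 k h) - f (truncated_series k h y)\<bar>
        \<le> e / 2 + 2 * B * (of_bool (h \<in> T1) + of_bool (h \<in> T2) + of_bool (h \<in> T3))"
      if "h \<in> cube k N" for h
    proof (cases "h \<in> T1 \<union> T2 \<union> T3")
      case True
      have "\<bar>f (series_or_0 k h) - f (truncated_series k h y)\<bar> \<le> 2 * B * 1"
        using f(2)[of "series_or_0 k h"] f(2)[of "truncated_series k h y"] by linarith
      also have "\<dots> \<le> 2 * B * (of_bool (h \<in> T1) + of_bool (h \<in> T2) + of_bool (h \<in> T3))"
        using True \<open>B \<ge> 0\<close> by (intro mult_left_mono) auto
      finally show ?thesis using \<open>e > 0\<close> by linarith
    next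
      case False
      then have h: "inj_on h {1..k}" "tail_sum k h y0 \<le> 1" "tail_sum k h y \<le> d"
        using that by (auto simp: T1_def T2_def T3_def)
      define s t where "s = truncated_series k h y" and "t = singular_series k h"
      have s: "s \<in> {0..K}" and t: "t \<in> {0..K}"
        using h truncated_series_le_size_bound[OF h(1,2), of y] singular_series_le_size_bound[OF h(1,2)]
        by (auto simp: s_def t_def K_def y_def truncated_series_nonneg singular_series_nonneg)
      have "\<bar>t - s\<bar> \<le> \<bar>s\<bar> * (exp (tail_sum k h y) - 1)"
        unfolding s_def t_def by (rule singular_series_diff_le[OF h(1)])
      also have "\<dots> \<le> K * (exp d - 1)"
        using s h tail_sum_nonneg[OF h(1), of y] \<open>K > 0\<close> by (intro mult_mono) auto
      also have "\<dots> = \<delta> / 2" using expd \<open>K > 0\<close> by simp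
      also have "\<dots> < \<delta>" using \<open>\<delta> > 0\<close> by simp
      finally have "\<bar>f t - f s\<bar> < e / 2"
        using \<delta>[OF s t] by (simp add: dist_real_def)
      then show ?thesis using h(1) False by (simp add: series_or_0_def s_def t_def)
    qed
    have "\<bar>(\<Sum>h\<in>cube k N. f (series_or_0 k h)) - (\<Sum>h\<in>cube k N. f (truncated_series k h y))\<bar>
        \<le> (\<Sum>h\<in>cube k N. \<bar>f (series_or_0 k h) - f (truncated_series k h y)\<bar>)"
      unfolding sum_subtractf[symmetric] by (rule sum_abs)
    also have "\<dots> \<le> (\<Sum>h\<in>cube k N. e / 2 + 2 * B * (of_bool (h \<in> T1) + of_bool (h \<in> T2) + of_bool (h \<in> T3)))"
      by (intro sum_mono pw)
    also have "\<dots> = e / 2 * real N ^ k + 2 * B * (real (card T1) + real (card T2) + real (card T3))"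
    proof -
      have *: "(\<Sum>h\<in>cube k N. of_bool (h \<in> T)) = real (card T)" if "T \<subseteq> cube k N" for T
        using finite_cube[of k N] that by (simp add: Int_absorb1)
      have sub: "T1 \<subseteq> cube k N" "T2 \<subseteq> cube k N" "T3 \<subseteq> cube k N"
        by (auto simp: T1_def T2_def T3_def)
      have "(\<Sum>h\<in>cube k N. e / 2) = e / 2 * real N ^ k"
        by (simp add: card_cube[simplified])
      then show ?thesis
        by (simp only: sum.distrib sum_distrib_left[symmetric] *[OF sub(1)] *[OF sub(2)] *[OF sub(3)])
    qed
    also have "\<dots> \<le> e / 2 * real N ^ k + 2 * B * (\<eta> * real N ^ k + \<eta> * real N ^ k + \<eta> * real N ^ k)"
      using T1 T2 T3 \<open>B \<ge> 0\<close> \<open>e > 0\<close> by (intro add_mono mult_left_mono) auto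
    also have "\<dots> = (e / 2 + 6 * B * \<eta>) * real N ^ k" by (simp add: algebra_simps)
    also have "6 * B * \<eta> = e / 2 * (B / (B + 1))"
      using \<open>B \<ge> 0\<close> by (simp add: \<eta>_def field_simps)
    also have "\<dots> \<le> e / 2 * 1"
      using \<open>B \<ge> 0\<close> \<open>e > 0\<close> by (intro mult_left_mono) auto
    finally have "\<bar>(\<Sum>h\<in>cube k N. f (series_or_0 k h)) - (\<Sum>h\<in>cube k N. f (truncated_series k h y))\<bar>
        \<le> e * real N ^ k"
      using Npos by (simp add: mult_right_mono)
    then show ?case
      using Npos by (simp add: diff_divide_distrib[symmetric] abs_divide pos_divide_le_eq del: of_nat_power)
  qed
  then show ?thesis by blast
qed

section \<open>Convergence of the averages\<close>

text \<open>The approximating sequence depends on \<open>e\<close>, so no limit is at hand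
  beforehand; the Cauchy criterion follows by passing through \<open>b\<close>.\<close>

lemma convergent_if_approximable:
  fixes a :: "nat \<Rightarrow> real"
  assumes "\<And>e. e > 0 \<Longrightarrow> \<exists>b. convergent b \<and> (\<forall>\<^sub>F n in sequentially. \<bar>a n - b n\<bar> \<le> e)"
  shows "convergent a"
proof -
  have "Cauchy a"
  proof (rule CauchyI)
    fix e :: real assume "e > 0"
    then obtain b where "convergent b" and ab: "\<forall>\<^sub>F n in sequentially. \<bar>a n - b n\<bar> \<le> e / 4"
      using assms[of "e / 4"] by auto
    obtain M1 where M1: "\<And>n. n \<ge> M1 \<Longrightarrow> \<bar>a n - b n\<bar> \<le> e / 4"
      using ab by (auto simp: eventually_sequentially)
    obtain M2 where M2: "\<And>m n. m \<ge> M2 \<Longrightarrow> n \<ge> M2 \<Longrightarrow> norm (b m - b n) < e / 4"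
      using CauchyD[OF convergent_Cauchy[OF \<open>convergent b\<close>], of "e / 4"] \<open>e > 0\<close> by auto
    have "norm (a m - a n) < e" if "m \<ge> max M1 M2" "n \<ge> max M1 M2" for m n
    proof -
      have "\<bar>b m - b n\<bar> < e / 4" using M2[of m n] that by simp
      then show ?thesis
        using M1[of m] M1[of n] that \<open>e > 0\<close> unfolding real_norm_def by linarith
    qed
    then show "\<exists>M. \<forall>m\<ge>M. \<forall>n\<ge>M. norm (a m - a n) < e" by blast
  qed
  then show ?thesis by (rule Cauchy_convergent)
qed

text \<open>For fixed \<open>y\<close> the truncated averages converge by periodicity modulo
  \<open>fact y\<close>, and they approximate the averages at hand.\<close>

lemma average_convergent:
  fixes f :: "real \<Rightarrow> real"
  assumes "k \<ge> 1" "continuous_on UNIV f" "\<And>x. \<bar>f x\<bar> \<le> B"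
  shows "convergent (\<lambda>N. (\<Sum>h\<in>cube k N. f (series_or_0 k h)) / real N ^ k)"
proof (rule convergent_if_approximable)
  fix e :: real assume "e > 0"
  have "convergent (\<lambda>N. (\<Sum>h\<in>cube k N. f (truncated_series k h y)) / real N ^ k)" for y
    by (rule convergentI, rule periodic_average[of "fact y"])
       (simp, simp only: truncated_series_periodic)
  then show "\<exists>b. convergent b \<and> (\<forall>\<^sub>F n in sequentially.
      \<bar>(\<Sum>h\<in>cube k n. f (series_or_0 k h)) / real n ^ k - b n\<bar> \<le> e)"
    using average_truncation[OF assms \<open>e > 0\<close>] by blast
qed

section \<open>Tightness and the limit law\<close>

text \<open>The side is \<open>Suc n\<close> because \<open>cube k 0\<close> is empty for
  \<open>k \<ge> 1\<close> and carries no uniform distribution. Taking the whole cube makes the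
  normalisation exactly \<open>Suc n ^ k\<close>.\<close>

definition empirical_law :: "nat \<Rightarrow> nat \<Rightarrow> real measure" where
  "empirical_law k n = distr (measure_pmf (pmf_of_set (cube k (Suc n)))) borel (series_or_0 k)"

lemma cube_Suc_nonempty: "cube k (Suc n) \<noteq> {}"
  by (simp add: PiE_eq_empty_iff)

lemma real_distribution_empirical_law: "real_distribution (empirical_law k n)"
  unfolding empirical_law_def by (rule prob_space.real_distribution_distr[OF measure_pmf.prob_space_axioms]) simp

lemma integral_empirical_law:
  fixes f :: "real \<Rightarrow> real"
  assumes "f \<in> borel_measurable borel"
  shows "integral\<^sup>L (empirical_law k n) f = (\<Sum>h\<in>cube k (Suc n). f (series_or_0 k h)) / real (Suc n) ^ k"
proof -
  have "integral\<^sup>L (empirical_law k n) f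
      = measure_pmf.expectation (pmf_of_set (cube k (Suc n))) (\<lambda>h. f (series_or_0 k h))"
    unfolding empirical_law_def by (rule integral_distr) (use assms in auto)
  also have "\<dots> = (\<Sum>h\<in>cube k (Suc n). f (series_or_0 k h)) / real (card (cube k (Suc n)))"
    by (rule integral_pmf_of_set[OF cube_Suc_nonempty finite_cube])
  finally show ?thesis by (simp only: card_cube of_nat_power)
qed

text \<open>Values above \<open>size_bound k y\<close> force \<open>tail_sum k h y > 1\<close>,
  which by Markov's inequality has frequency at most \<open>tail_bound k y\<close>, for all sides at
  once.\<close>

lemma tight_empirical_law:
  assumes "k \<ge> 1"
  shows "tight (empirical_law k)"
  unfolding tight_def
proof (intro conjI allI impI real_distribution_empirical_law)
  fix e :: real assume "e > 0"
  then obtain y where y: "tail_bound k y < e" using tail_bound_small by blast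
  \<comment> \<open>The interval is open on the left and must contain the value 0, hence the
    endpoint -1.\<close>
  have "measure (empirical_law k n) {-1<..size_bound k y} > 1 - e" for n
  proof -
    define C where "C = cube k (Suc n)"
    define G where "G = C \<inter> series_or_0 k -` {-1<..size_bound k y}"
    define T where "T = {h \<in> C. inj_on h {1..k} \<and> tail_sum k h y > 1}"
    have finC: "finite C" unfolding C_def by (rule finite_cube)
    have cardC: "real (card C) = real (Suc n) ^ k" unfolding C_def by (simp only: card_cube of_nat_power)
    have "C \<subseteq> G \<union> T"
    proof
      fix h assume "h \<in> C"
      have "series_or_0 k h > -1" using series_or_0_nonneg[of k h] by linarith
      moreover have "series_or_0 k h \<le> size_bound k y" if "h \<notin> T"
        using that \<open>h \<in> C\<close> singular_series_le_size_bound[of h k y] size_bound_pos[of k y]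
        by (auto simp: series_or_0_def T_def)
      ultimately show "h \<in> G \<union> T" using \<open>h \<in> C\<close> by (auto simp: G_def)
    qed
    then have "card C \<le> card (G \<union> T)"
      using finC by (intro card_mono) (auto simp: G_def T_def)
    also have "\<dots> \<le> card G + card T" by (rule card_Un_le)
    finally have "real (card C) \<le> real (card G) + real (card T)" by simp
    also have "real (card T) \<le> real (card C) * tail_bound k y"
      using card_large_tail_le[OF assms, of 1 "Suc n" y] cardC by (simp add: T_def C_def)
    finally have "real (card C) * (1 - tail_bound k y) \<le> real (card G)"
      by (simp add: algebra_simps)
    then have "1 - tail_bound k y \<le> real (card G) / real (card C)"
      using cardC by (simp add: pos_le_divide_eq mult.commute)
    also have "\<dots> = measure (empirical_law k n) {-1<..size_bound k y}"
      unfolding empirical_law_def G_def C_def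
      by (simp add: measure_distr measure_pmf_of_set[OF cube_Suc_nonempty[simplified] finite_cube[simplified]])
    finally show ?thesis using y by simp
  qed
  then show "\<exists>a b. a < b \<and> (\<forall>n. 1 - e < measure (empirical_law k n) {a<..b})"
    using size_bound_pos[of k y] by (intro exI[of _ "-1"] exI[of _ "size_bound k y"]) auto
qed

text \<open>Helly's theorem provides a limit along a subsequence only. The averages of each
  \<open>f\<close> are already known to converge, so the subsequence identifies the limit of the
  full sequence.\<close>

lemma limit_law_exists:
  assumes "k \<ge> 1"
  shows "\<exists>M. real_distribution M \<and>
    (\<forall>f B. continuous_on UNIV f \<longrightarrow> (\<forall>x. \<bar>f x\<bar> \<le> B) \<longrightarrow>
      (\<lambda>N. (\<Sum>h\<in>cube k N. f (series_or_0 k h)) / real N ^ k) \<longlonglongrightarrow> integral\<^sup>L M f)"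
proof -
  obtain r M where r: "strict_mono (r :: nat \<Rightarrow> nat)" and M: "real_distribution M"
    and conv: "weak_conv_m (empirical_law k \<circ> id \<circ> r) M"
    using tight_imp_convergent_subsubsequence[OF tight_empirical_law[OF assms] strict_mono_id] by blast
  have "(\<lambda>N. (\<Sum>h\<in>cube k N. f (series_or_0 k h)) / real N ^ k) \<longlonglongrightarrow> integral\<^sup>L M f"
    if f: "continuous_on UNIV f" "\<And>x. \<bar>f x\<bar> \<le> B" for f :: "real \<Rightarrow> real" and B
  proof -
    define a where "a = (\<lambda>N. (\<Sum>h\<in>cube k N. f (series_or_0 k h)) / real N ^ k)"
    have "(\<lambda>n. integral\<^sup>L ((empirical_law k \<circ> id \<circ> r) n) f) \<longlonglongrightarrow> integral\<^sup>L M f"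
      using f by (intro weak_conv_imp_integral_bdd_continuous_conv[OF _ M conv])
        (auto simp: real_distribution_empirical_law continuous_on_eq_continuous_at)
    then have "(\<lambda>n. a (Suc (r n))) \<longlonglongrightarrow> integral\<^sup>L M f"
      using borel_measurable_continuous_onI[OF f(1)] by (simp only: integral_empirical_law o_def id_def a_def)
    moreover obtain L where L: "a \<longlonglongrightarrow> L"
      using average_convergent[OF assms f] unfolding a_def convergent_def by blast
    have "(\<lambda>n. a (Suc (r n))) \<longlonglongrightarrow> L"
      using LIMSEQ_subseq_LIMSEQ[OF L, of "\<lambda>n. Suc (r n)"] r by (simp add: strict_mono_def o_def)
    ultimately have "L = integral\<^sup>L M f" by (metis LIMSEQ_unique)
    then show ?thesis using L by (simp add: a_def)
  qed
  then show ?thesis using M by blast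
qed

section \<open>Real cutoffs and restriction to the half-line\<close>

text \<open>The set of tuples depends on the integer part of \<open>H\<close> alone, whereas the
  normalisation is by \<open>H ^ k\<close>; this ratio reconciles the two.\<close>

lemma floor_ratio_tendsto_1: "((\<lambda>H::real. real (nat \<lfloor>H\<rfloor>) / H) \<longlongrightarrow> 1) at_top"
proof (rule tendsto_sandwich)
  show "\<forall>\<^sub>F H in at_top. 1 - 1 / H \<le> real (nat \<lfloor>H\<rfloor>) / H"
    using eventually_gt_at_top[of 0]
  proof eventually_elim
    case (elim H)
    have "H - 1 \<le> real (nat \<lfloor>H\<rfloor>)" using elim by linarith
    then have "(H - 1) / H \<le> real (nat \<lfloor>H\<rfloor>) / H" using elim by (intro divide_right_mono) auto
    then show ?case using elim by (simp add: diff_divide_distrib)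
  qed
  show "\<forall>\<^sub>F H in at_top. real (nat \<lfloor>H\<rfloor>) / H \<le> 1"
    using eventually_gt_at_top[of 0] by eventually_elim (simp add: divide_le_eq of_nat_floor)
  have "((\<lambda>H::real. 1 - 1 / H) \<longlongrightarrow> 1 - 0) at_top"
    by (intro tendsto_intros tendsto_divide_0[OF tendsto_const] filterlim_at_top_imp_at_infinity filterlim_ident)
  then show "((\<lambda>H::real. 1 - 1 / H) \<longlongrightarrow> 1) at_top" by simp
qed simp

theorem theorem1p2:
  fixes k :: nat
  assumes "k \<ge> 1"
  shows "\<exists>\<nu> :: real measure.
           prob_space \<nu> \<and> sets \<nu> = sets (restrict_space borel {0..}) \<and>
           (\<forall>f :: real \<Rightarrow> real. continuous_on UNIV f \<longrightarrow> bounded (range f) \<longrightarrow>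
              ((\<lambda>H :: real. (1 / H ^ k) * (\<Sum>h\<in>distinct_tuples k H. f (singular_series k h)))
                 \<longlongrightarrow> (\<integral>t. f t \<partial>\<nu>)) at_top)"
proof -
  obtain M where M: "real_distribution M"
    and lim: "\<And>f B. continuous_on UNIV f \<Longrightarrow> (\<And>x. \<bar>f x\<bar> \<le> B) \<Longrightarrow>
      (\<lambda>N. (\<Sum>h\<in>cube k N. f (series_or_0 k h)) / real N ^ k) \<longlonglongrightarrow> integral\<^sup>L M f"
    using limit_law_exists[OF assms] by blast
  interpret M: real_distribution M by (rule M)
  have AE: "AE x in M. x \<in> {0..}"
  proof -
    \<comment> \<open>A bounded continuous nonnegative function that vanishes exactly on
      \<open>{0..}\<close>. Its averages are 0, hence so is its integral, and \<open>M\<close> lives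
      on the half-line.\<close>
    define f where "f = (\<lambda>x::real. min 1 (max 0 (- x)))"
    have cont: "continuous_on UNIV f" unfolding f_def by (intro continuous_intros)
    have "f (series_or_0 k h) = 0" for h
      using series_or_0_nonneg[of k h] by (simp add: f_def)
    then have "integral\<^sup>L M f = 0"
      using lim[OF cont, of 1] LIMSEQ_const_iff[of "0::real"] by (simp add: f_def)
    moreover have "integrable M f"
      using borel_measurable_continuous_onI[OF cont]
      by (intro M.integrable_const_bound[of _ 1]) (auto simp: f_def)
    ultimately have "AE x in M. f x = 0"
      by (subst (asm) integral_nonneg_eq_0_iff_AE) (auto simp: f_def)
    then show ?thesis by eventually_elim (auto simp: f_def min_def max_def split: if_splits)
  qed
  define \<nu> where "\<nu> = restrict_space M {0..}"
  have "prob_space \<nu>"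
    unfolding \<nu>_def using AE by (intro prob_space_restrict_space M.emeasure_eq_1_AE) auto
  moreover have "sets \<nu> = sets (restrict_space borel {0..})"
    unfolding \<nu>_def by (intro sets_restrict_space_cong) simp
  moreover have "((\<lambda>H :: real. (1 / H ^ k) * (\<Sum>h\<in>distinct_tuples k H. f (singular_series k h)))
                 \<longlongrightarrow> (\<integral>t. f t \<partial>\<nu>)) at_top"
    if f: "continuous_on UNIV f" "bounded (range f)" for f :: "real \<Rightarrow> real"
  proof -
    obtain B where B: "\<And>x. \<bar>f x\<bar> \<le> B" using f(2) by (auto simp: bounded_iff)
    have [measurable]: "f \<in> borel_measurable borel"
      by (rule borel_measurable_continuous_onI[OF f(1)])
    have "(\<integral>t. f t \<partial>\<nu>) = (\<integral>t. indicator {0..} t *\<^sub>R f t \<partial>M)"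
      unfolding \<nu>_def by (rule integral_restrict_space) simp
    also have "\<dots> = integral\<^sup>L M f"
      using AE by (intro integral_cong_AE) auto
    finally have int: "(\<integral>t. f t \<partial>\<nu>) = integral\<^sup>L M f" .
    define D where "D = (\<lambda>N. {h \<in> cube k N. inj_on h {1..k}})"
    define E where "E = (\<lambda>N. {h \<in> cube k N. \<not> inj_on h {1..k}})"
    define a where "a = (\<lambda>N. (\<Sum>h\<in>D N. f (singular_series k h)) / real N ^ k)"
    \<comment> \<open>Each tuple with a repeated component contributes \<open>f 0\<close> to the sum
      over the cube; this total contribution is negligible after normalisation, and subtracting it
      leaves the distinct tuples.\<close>
    have "(\<lambda>N. real (card (E N)) / real N ^ k * f 0) \<longlonglongrightarrow> 0 * f 0"
    proof (intro tendsto_mult tendsto_const)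
      show "(\<lambda>N. real (card (E N)) / real N ^ k) \<longlonglongrightarrow> 0"
      proof (rule Lim_null_comparison)
        show "(\<lambda>N. real k ^ 2 / real N) \<longlonglongrightarrow> 0" by (rule lim_const_over_n)
        show "\<forall>\<^sub>F N in sequentially. norm (real (card (E N)) / real N ^ k) \<le> real k ^ 2 / real N"
          using eventually_gt_at_top[of 0]
        proof eventually_elim
          case (elim N)
          have "real (card (E N)) / real N ^ k \<le> (real k ^ 2 * real N ^ (k - 1)) / real N ^ k"
            unfolding E_def by (intro divide_right_mono card_not_inj_le) auto
          also have "\<dots> = real k ^ 2 / real N"
            using assms elim by (cases k) auto
          finally show ?case by simp
        qed
      qed
    qed
    then have "(\<lambda>N. (\<Sum>h\<in>cube k N. f (series_or_0 k h)) / real N ^ k - real (card (E N)) / real N ^ k * f 0)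
        \<longlonglongrightarrow> integral\<^sup>L M f - 0 * f 0"
      by (intro tendsto_diff lim[OF f(1) B])
    moreover have "(\<Sum>h\<in>cube k N. f (series_or_0 k h)) / real N ^ k - real (card (E N)) / real N ^ k * f 0 = a N" for N
    proof -
      have "cube k N = D N \<union> E N" "D N \<inter> E N = {}" by (auto simp: D_def E_def)
      moreover have "finite (D N)" "finite (E N)" using finite_cube by (auto simp: D_def E_def)
      ultimately have "(\<Sum>h\<in>cube k N. f (series_or_0 k h))
          = (\<Sum>h\<in>D N. f (series_or_0 k h)) + (\<Sum>h\<in>E N. f (series_or_0 k h))"
        by (simp only: sum.union_disjoint)
      also have "(\<Sum>h\<in>D N. f (series_or_0 k h)) = (\<Sum>h\<in>D N. f (singular_series k h))"
        by (intro sum.cong) (auto simp: D_def series_or_0_def)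
      also have "(\<Sum>h\<in>E N. f (series_or_0 k h)) = (\<Sum>h\<in>E N. f 0)"
        by (intro sum.cong) (auto simp: E_def series_or_0_def)
      finally show ?thesis by (simp add: a_def add_divide_distrib)
    qed
    ultimately have a: "a \<longlonglongrightarrow> integral\<^sup>L M f" by simp
    have "filterlim (\<lambda>H::real. nat \<lfloor>H\<rfloor>) sequentially at_top"
      by (rule filterlim_compose[OF filterlim_nat_sequentially filterlim_floor_sequentially])
    then have "((\<lambda>H. (real (nat \<lfloor>H\<rfloor>) / H) ^ k * a (nat \<lfloor>H\<rfloor>)) \<longlongrightarrow> 1 ^ k * integral\<^sup>L M f) at_top"
      by (intro tendsto_mult tendsto_power floor_ratio_tendsto_1 filterlim_compose[OF a])
    moreover have "\<forall>\<^sub>F H in at_top. (real (nat \<lfloor>H\<rfloor>) / H) ^ k * a (nat \<lfloor>H\<rfloor>)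
        = (1 / H ^ k) * (\<Sum>h\<in>distinct_tuples k H. f (singular_series k h))"
      \<comment> \<open>For \<open>H \<ge> 1\<close> the integer part is positive, so the power of
        \<open>N\<close> in the ratio cancels the denominator of \<open>a N\<close>.\<close>
      using eventually_ge_at_top[of 1]
    proof eventually_elim
      case (elim H)
      define N where "N = nat \<lfloor>H\<rfloor>"
      have "real N > 0" using elim unfolding N_def by linarith
      then show ?case
        unfolding a_def D_def distinct_tuples_eq[OF assms] N_def[symmetric] by (simp add: power_divide)
    qed
    ultimately show ?thesis
      unfolding int by (simp add: tendsto_cong)
  qed
  ultimately show ?thesis by blast
qed

end
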